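(* Let $n,m\ge 3$ and $l\ge 1$ be integers, and let $C_n\cdot P_l\cdot C_m$ be the dumbbell graph. Then $$\nu(C_n\cdot P_l\cdot C_m)=\Big\lfloor\frac{n}{3}\Big\rfloor+\Big\lfloor\frac{m}{3}\Big\rfloor+\Big\lfloor\frac{l-\xi_3(n)-\xi_3(m)+1}{3}\Big\rfloor .$$
   Context: All graphs are finite, simple and undirected. The dumbbell graph $C_n\cdot P_l\cdot C_m$ consists of a cycle $C_n$ on vertices $x_1,\dots,x_n$, a cycle $C_m$ on vertices $y_1,\dots,y_m$, and a path $P_l$ with $l$ vertices $z_1,\dots,z_l$ (and $l-1$ edges $z_iz_{i+1}$), with the identifications $x_1=z_1$ and $y_1=z_l$ and no other identifications or edges; for $l=1$ the two cycles share exactly the vertex $x_1=y_1=z_1$. An induced matching of a graph $G$ is a set of pairwise disjoint edges such that the subgraph of $G$ induced on the union of their endpoints has no other edges; $\nu(G)$, the induced matching number, is the maximum size of an induced matching of $G$. The function $\xi_3$ is defined by $\xi_3(n)=1$ if $n\equiv 0,1 \pmod 3$ and $\xi_3(n)=0$ if $n\equiv 2\pmod 3$. *)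

theory Defs
  imports Complex_Main
begin

text \<open>
  An undirected graph is a pair of a vertex set and a set of edges, each edge being an
  unordered pair of vertices. The conditions for it to be finite and simple are
  collected in \<open>fin_simple_graph\<close>.
\<close>

type_synonym 'a graph = "'a set \<times> 'a set set"

definition verts :: "'a graph \<Rightarrow> 'a set" where
  "verts G = fst G"

definition edges :: "'a graph \<Rightarrow> 'a set set" where
  "edges G = snd G"

definition fin_simple_graph :: "'a graph \<Rightarrow> bool" where
  "fin_simple_graph G \<longleftrightarrow> finite (verts G) \<and> (\<forall>e\<in>edges G. e \<subseteq> verts G \<and> card e = 2)"

definition induced_subgraph :: "'a graph \<Rightarrow> 'a set \<Rightarrow> 'a graph" where
  "induced_subgraph G W = (W, {e \<in> edges G. e \<subseteq> W})"

definition induced_matching :: "'a graph \<Rightarrow> 'a set set \<Rightarrow> bool" where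
  "induced_matching G M \<longleftrightarrow>
     M \<subseteq> edges G \<and> pairwise disjnt M \<and> edges (induced_subgraph G (\<Union>M)) = M"

definition induced_matching_number :: "'a graph \<Rightarrow> nat" where
  "induced_matching_number G = Max (card ` {M. induced_matching G M})"

definition path_edges :: "nat \<Rightarrow> (nat \<Rightarrow> 'a) \<Rightarrow> 'a set set" where
  "path_edges k v = {{v i, v (i + 1)} | i. 1 \<le> i \<and> i < k}"

definition cycle_edges :: "nat \<Rightarrow> (nat \<Rightarrow> 'a) \<Rightarrow> 'a set set" where
  "cycle_edges k v = path_edges k v \<union> {{v k, v 1}}"

text \<open>
  The identifications \<open>x\<^sub>1 = z\<^sub>1\<close> and \<open>y\<^sub>1 = z\<^sub>l\<close> are made by taking the path vertices
  \<open>Z 1\<close> and \<open>Z l\<close> as representatives. No other vertices are identified, because \<open>X\<close>, \<open>Y\<close>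
  and \<open>Z\<close> are distinct free constructors.
\<close>

datatype dvertex = X nat | Y nat | Z nat

definition dx :: "nat \<Rightarrow> dvertex" where
  "dx i = (if i = 1 then Z 1 else X i)"

definition dy :: "nat \<Rightarrow> nat \<Rightarrow> dvertex" where
  "dy l i = (if i = 1 then Z l else Y i)"

definition dumbbell :: "nat \<Rightarrow> nat \<Rightarrow> nat \<Rightarrow> dvertex graph" where
  "dumbbell n l m =
     (dx ` {1..n} \<union> Z ` {1..l} \<union> dy l ` {1..m},
      cycle_edges n dx \<union> path_edges l Z \<union> cycle_edges m (dy l))"

definition xi3 :: "nat \<Rightarrow> nat" where
  "xi3 n = (if n mod 3 = 0 \<or> n mod 3 = 1 then 1 else 0)"

lemma fin_simple_graph_dumbbell:
  assumes "n \<ge> 3" "m \<ge> 3" "l \<ge> 1"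
  shows "fin_simple_graph (dumbbell n l m)"
  using assms
  by (auto simp: fin_simple_graph_def dumbbell_def verts_def edges_def cycle_edges_def
      path_edges_def dx_def dy_def card_insert_if)

lemma induced_matching_empty:
  assumes "fin_simple_graph G"
  shows "induced_matching G {}"
  using assms
  by (auto simp: induced_matching_def induced_subgraph_def fin_simple_graph_def edges_def)

lemma finite_induced_matchings:
  assumes "fin_simple_graph G"
  shows "finite {M. induced_matching G M}"
proof -
  have "edges G \<subseteq> Pow (verts G)"
    using assms by (auto simp: fin_simple_graph_def)
  then have "finite (edges G)"
    using assms by (meson fin_simple_graph_def finite_Pow_iff finite_subset)
  moreover have "{M. induced_matching G M} \<subseteq> Pow (edges G)"
    by (auto simp: induced_matching_def)
  ultimately show ?thesis
    by (meson finite_Pow_iff finite_subset)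
qed

end

theory Submission
  imports Defs
begin

text \<open>
  Along any sequence of edges in which consecutive edges meet, two different edges of an induced matching
  are at least three steps apart: one step apart they would share a vertex, and two steps apart
  the edge between them would join them. Hence a path with \<open>k\<close> edges holds at most
  \<open>(k + 2) div 3\<close> edges of the matching, and a cycle of length \<open>n\<close>, where the spacing also
  applies across the closing point, at most \<open>n div 3\<close>.

  The two cycles and the path interact only where they are glued together. If the first path
  edge is matched, then the two cycle edges on either side of the junction are all lost, and
  the others hold at most \<open>(n - 2) div 3 = n div 3 - xi3 n\<close> matching edges. So
  \<open>xi3 n\<close> is the price, in cycle edges, of matching the end edge of the path. When the price is
  0, a maximum matching of the cycle can avoid the junction and both its neighbours. When it is 1,
  giving up the end edge of the path costs no more than paying: a path with one edge fewer
  loses at most one matching edge. The maximum is therefore reached by filling both cycles and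
  shortening the path by \<open>xi3 n\<close> at one end and by \<open>xi3 m\<close> at the other, which leaves
  \<open>l - xi3 n - xi3 m\<close> path vertices for \<open>(l - xi3 n - xi3 m + 1) div 3\<close> more edges.

  The upper bound is \<open>card_induced_matching_dumbbell_le\<close>, from \<open>card_matching_cycle_le\<close> and
  \<open>card_matching_path_le\<close>. The matching that attains it takes every third edge of each part,
  with the starting points chosen in \<open>every_third_edge_cycle\<close> and
  \<open>dumbbell_induced_matching_exists\<close>.
\<close>

section \<open>Separation in induced matchings\<close>

text \<open>
  An edge that meets two different matching edges has one endpoint in each of them, so it lies
  in the subgraph induced by the matching and must itself be a matching edge. It would then
  share a vertex with another matching edge.
\<close>

lemma induced_matching_apart:
  assumes "fin_simple_graph G" "induced_matching G M"
    and "e \<in> M" "f \<in> M" "e \<noteq> f" "g \<in> edges G"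
  shows "g \<inter> e = {} \<or> g \<inter> f = {}"
proof (rule ccontr)
  assume "\<not> ?thesis"
  then obtain x y where xy: "x \<in> g" "x \<in> e" "y \<in> g" "y \<in> f" by blast
  have disj: "pairwise disjnt M" and ind: "{h \<in> edges G. h \<subseteq> \<Union>M} = M"
    using assms(2) by (auto simp: induced_matching_def induced_subgraph_def edges_def)
  have "e \<inter> f = {}"
    using disj assms(3-5) by (auto simp: pairwise_def disjnt_def)
  with xy have "x \<noteq> y" by blast
  moreover have "card g = 2"
    using assms(1,6) by (auto simp: fin_simple_graph_def)
  ultimately have "g = {x, y}"
    using xy by (auto simp: card_2_iff)
  then have "g \<in> M"
    using ind xy assms(3,4,6) by blast
  moreover have "g \<inter> e \<noteq> {}" "g \<inter> f \<noteq> {}" using xy by auto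
  ultimately have "g = e" "g = f"
    using disj assms(3,4) unfolding pairwise_def disjnt_def by blast+
  with assms(5) show False by simp
qed

lemma induced_matching_disjoint:
  assumes "fin_simple_graph G" "induced_matching G M"
    and "e \<in> M" "f \<in> M" "e \<noteq> f"
  shows "e \<inter> f = {}"
  using assms unfolding induced_matching_def pairwise_def disjnt_def by blast

lemma matching_edges_along_walk_spaced:
  fixes E :: "nat \<Rightarrow> 'a set"
  assumes "fin_simple_graph G" "induced_matching G M"
    and "E i \<in> M" "E j \<in> M" "E i \<noteq> E j" "i < j"
    and "\<And>k. i \<le> k \<Longrightarrow> k < j \<Longrightarrow> E k \<in> edges G"
    and "\<And>k. i \<le> k \<Longrightarrow> k < j \<Longrightarrow> E k \<inter> E (Suc k) \<noteq> {}"
  shows "i + 3 \<le> j"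
proof (rule ccontr)
  assume "\<not> ?thesis"
  with \<open>i < j\<close> consider "j = Suc i" | "j = Suc (Suc i)" by linarith
  then show False
  proof cases
    case 1
    then show ?thesis
      using assms(8)[of i] induced_matching_disjoint[OF assms(1-5)] by simp
  next
    case 2
    then show ?thesis
      using assms(8)[of i] assms(8)[of "Suc i"] assms(7)[of "Suc i"]
        induced_matching_apart[OF assms(1-5), of "E (Suc i)"]
      by (simp add: Int_commute)
  qed
qed

text \<open>
  Cut the interval into blocks of three. Each block contains at most one element of the spaced
  set, so the block number is injective on it.
\<close>

lemma card_spaced_le:
  fixes A :: "nat set"
  assumes "\<And>i j. i \<in> A \<Longrightarrow> j \<in> A \<Longrightarrow> i < j \<Longrightarrow> i + 3 \<le> j"
    and "A \<subseteq> {a..<b}"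
  shows "card A \<le> (b - a + 2) div 3"
proof -
  have "(i - a) div 3 \<noteq> (j - a) div 3" if "i \<in> A" "j \<in> A" "i < j" for i j
  proof -
    have "a \<le> i" "i + 3 \<le> j" using assms that by auto
    then have "(i - a) + 3 \<le> j - a" by linarith
    then show ?thesis by linarith
  qed
  then have "inj_on (\<lambda>i. (i - a) div 3) A"
    by (metis (no_types, lifting) inj_onI linorder_neqE_nat)
  moreover have "(\<lambda>i. (i - a) div 3) ` A \<subseteq> {..<(b - a + 2) div 3}"
  proof (rule image_subsetI)
    fix i assume "i \<in> A"
    then have "a \<le> i" "i < b" using assms(2) by auto
    then show "(i - a) div 3 \<in> {..<(b - a + 2) div 3}" unfolding lessThan_iff by linarith
  qed
  ultimately have "card A \<le> card {..<(b - a + 2) div 3}"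
    by (meson card_inj_on_le finite_lessThan)
  then show ?thesis by simp
qed

section \<open>Upper bounds along paths and cycles\<close>

text \<open>
  The window \<open>{a..<b}\<close> of possible indices is a parameter because end edges of the path that
  are known to be unmatched improve the bound.
\<close>

lemma card_matching_path_le:
  assumes G: "fin_simple_graph G" "induced_matching G M"
    and "path_edges k v \<subseteq> edges G" "inj_on v {1..k}"
    and "\<And>i. 1 \<le> i \<Longrightarrow> i < k \<Longrightarrow> {v i, v (i + 1)} \<in> M \<Longrightarrow> a \<le> i \<and> i < b"
  shows "card (M \<inter> path_edges k v) \<le> (b - a + 2) div 3"
proof -
  define E where "E = (\<lambda>i. {v i, v (i + 1)})"
  define A where "A = {i. 1 \<le> i \<and> i < k \<and> E i \<in> M}"
  have E_ne: "E i \<noteq> E j" if "1 \<le> i" "i < j" "j < k" for i j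
    using that inj_onD[OF assms(4), of i j] inj_onD[OF assms(4), of i "j + 1"]
    by (auto simp: E_def doubleton_eq_iff)
  have E_edge: "E i \<in> edges G" if "1 \<le> i" "i < k" for i
    using that assms(3) by (auto simp: E_def path_edges_def)
  have "A \<subseteq> {a..<b}"
    using assms(5) by (auto simp: A_def E_def)
  moreover have "i + 3 \<le> j" if "i \<in> A" "j \<in> A" "i < j" for i j
  proof (rule matching_edges_along_walk_spaced[OF G, of E])
    show "E i \<in> M" "E j \<in> M" "E i \<noteq> E j" "i < j"
      using that E_ne[of i j] by (auto simp: A_def)
    show "E k' \<in> edges G" if "i \<le> k'" "k' < j" for k'
      using that \<open>i \<in> A\<close> \<open>j \<in> A\<close> by (intro E_edge) (auto simp: A_def)
  qed (simp add: E_def)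
  ultimately have "card A \<le> (b - a + 2) div 3"
    by (intro card_spaced_le)
  moreover have "M \<inter> path_edges k v \<subseteq> E ` A"
    by (auto simp: A_def E_def path_edges_def)
  moreover have "finite A" unfolding A_def by simp
  ultimately show ?thesis
    by (meson card_image_le card_mono finite_imageI le_trans)
qed

text \<open>
  Edges are numbered from 0, and periodically over all naturals, so that going once around the
  cycle is again a sequence of edges in which consecutive ones meet and the linear spacing
  lemma applies across the closing edge.
\<close>

definition cyclic_edge :: "nat \<Rightarrow> (nat \<Rightarrow> 'a) \<Rightarrow> nat \<Rightarrow> 'a set" where
  "cyclic_edge n v i = {v (i mod n + 1), v (Suc i mod n + 1)}"

lemma cycle_edges_eq_image:
  assumes "n \<ge> 1"
  shows "cycle_edges n v = cyclic_edge n v ` {..<n}"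
proof -
  have *: "cyclic_edge n v i = (if Suc i = n then {v n, v 1} else {v (i + 1), v (i + 2)})"
    if "i < n" for i
    using that by (auto simp: cyclic_edge_def)
  have "path_edges n v \<subseteq> cyclic_edge n v ` {..<n}"
  proof
    fix e assume "e \<in> path_edges n v"
    then obtain i where "1 \<le> i" "i < n" "e = {v i, v (i + 1)}"
      by (auto simp: path_edges_def)
    then show "e \<in> cyclic_edge n v ` {..<n}"
      using *[of "i - 1"] by (intro image_eqI[of _ _ "i - 1"]) auto
  qed
  moreover have "{v n, v 1} \<in> cyclic_edge n v ` {..<n}"
    using *[of "n - 1"] assms by (intro image_eqI[of _ _ "n - 1"]) auto
  moreover have "cyclic_edge n v i \<in> cycle_edges n v" if "i < n" for i
  proof (cases "Suc i = n")
    case True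
    then show ?thesis using *[OF that] by (simp add: cycle_edges_def)
  next
    case False
    then have "cyclic_edge n v i \<in> path_edges n v"
      using *[OF that] that unfolding path_edges_def mem_Collect_eq
      by (intro exI[of _ "i + 1"]) auto
    then show ?thesis by (simp add: cycle_edges_def)
  qed
  ultimately show ?thesis by (auto simp: cycle_edges_def)
qed

lemma cyclic_edge_inj:
  assumes "n \<ge> 3" "inj_on v {1..n}" "i < n" "j < n" "cyclic_edge n v i = cyclic_edge n v j"
  shows "i = j"
proof -
  have inj: "a = b" if "v (a + 1) = v (b + 1)" "a < n" "b < n" for a b
    using inj_onD[OF assms(2) that(1)] that by auto
  have lt: "Suc i mod n < n" "Suc j mod n < n" using assms by auto
  have "i = j \<or> i = Suc j mod n \<and> Suc i mod n = j"
    using assms(3-5) inj lt unfolding cyclic_edge_def doubleton_eq_iff by (metis mod_less)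
  moreover have "\<not> (i = Suc j mod n \<and> Suc i mod n = j)"
    using assms(1,3,4) by (auto simp: mod_Suc split: if_splits)
  ultimately show ?thesis by blast
qed

text \<open>
  For the first bound, start at the first matching edge \<open>a\<close>. Since \<open>a\<close> returns at position
  \<open>a + n\<close>, all matching edges have positions in \<open>{a..<a + n - 2}\<close>. In the second bound \<open>p\<close> is a
  matching edge outside the cycle that hangs at \<open>v 1\<close>. It rules out the two edges at \<open>v 1\<close>, which
  touch it, and the two edges next to these, which would be joined to it. Positions \<open>2\<close> to
  \<open>n - 3\<close> remain.
\<close>

lemma card_matching_cycle_le:
  assumes G: "fin_simple_graph G" "induced_matching G M"
    and n: "n \<ge> 3" and C: "cycle_edges n v \<subseteq> edges G" "inj_on v {1..n}"
  shows "card (M \<inter> cycle_edges n v) \<le> n div 3"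
    and "\<lbrakk>p \<in> M; v 1 \<in> p; p \<notin> cycle_edges n v\<rbrakk>
          \<Longrightarrow> card (M \<inter> cycle_edges n v) \<le> n div 3 - xi3 n"
proof -
  define E where "E = cyclic_edge n v"
  define A where "A = {i. i < n \<and> E i \<in> M}"
  have C_eq: "cycle_edges n v = E ` {..<n}"
    using n by (simp add: E_def cycle_edges_eq_image)
  have E_period: "E (i + n) = E i" for i
    by (simp add: E_def cyclic_edge_def mod_Suc)
  have E_mod: "E i = E (i mod n)" for i
    by (simp add: E_def cyclic_edge_def mod_Suc_eq)
  have E_edge: "E i \<in> edges G" for i
    using C(1) C_eq E_mod[of i] n by auto
  have E_meet: "E i \<inter> E (Suc i) \<noteq> {}" for i
    by (auto simp: E_def cyclic_edge_def)
  have E_ne: "E i \<noteq> E j" if "i < n" "j < n" "i \<noteq> j" for i j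
    using that n C(2) cyclic_edge_inj unfolding E_def by blast
  have spaced: "i + 3 \<le> j" if "i \<in> A" "j \<in> A" "i < j" for i j
    using that E_ne E_edge E_meet
    by (intro matching_edges_along_walk_spaced[OF G, of E]) (auto simp: A_def)
  have finA: "finite A" unfolding A_def by simp
  have "M \<inter> cycle_edges n v \<subseteq> E ` A"
    by (auto simp: C_eq A_def)
  then have card_le: "card (M \<inter> cycle_edges n v) \<le> card A"
    by (meson card_image_le card_mono finA finite_imageI le_trans)
  have "card A \<le> n div 3"
  proof (cases "A = {}")
    case False
    define a where "a = Min A"
    have a: "a \<in> A" "\<And>i. i \<in> A \<Longrightarrow> a \<le> i"
      using False finA by (auto simp: a_def)
    have "j + 3 \<le> a + n" if "j \<in> A" for j
    proof (cases "j = a")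
      case True
      then show ?thesis using n by simp
    next
      case False
      (* compare j with the next occurrence of a, at position a + n *)
      then show ?thesis
        using that a(1) E_ne[of j a] E_period[of a] E_edge E_meet
        by (intro matching_edges_along_walk_spaced[OF G, of E]) (auto simp: A_def)
    qed
    then have "A \<subseteq> {a..<a + n - 2}"
      using a(2) by fastforce
    then have "card A \<le> (a + n - 2 - a + 2) div 3"
      using spaced by (intro card_spaced_le)
    then show ?thesis using n by simp
  qed simp
  with card_le show "card (M \<inter> cycle_edges n v) \<le> n div 3" by simp
  assume p: "p \<in> M" "v 1 \<in> p" "p \<notin> cycle_edges n v"
  have not_met: "E i \<notin> M" if "g \<in> edges G" "g \<inter> E i \<noteq> {}" "v 1 \<in> g" "i < n" for g i
  proof
    assume "E i \<in> M"
    moreover have "E i \<noteq> p" using p(3) C_eq that by auto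
    ultimately show False
      using induced_matching_apart[OF G _ p(1), of "E i" g] that p(2) by blast
  qed
  have v1: "v 1 \<in> E 0" "v 1 \<in> E (n - 1)"
    using n by (auto simp: E_def cyclic_edge_def)
  have "E 0 \<notin> M" "E 1 \<notin> M"
    using not_met[of "E 0" 0] not_met[of "E 0" 1] E_edge E_meet[of 0] v1 n by auto
  moreover have "E (n - 1) \<notin> M"
    using not_met[of "E (n - 1)" "n - 1"] E_edge v1 n by auto
  moreover have "E (n - 2) \<notin> M"
  proof -
    have "Suc (n - 2) = n - 1" using n by simp
    then show ?thesis
      using not_met[of "E (n - 1)" "n - 2"] E_edge E_meet[of "n - 2"] v1 n by auto
  qed
  ultimately have "i \<in> {2..<n - 2}" if "i \<in> A" for i
  proof -
    have "i \<noteq> 0" "i \<noteq> 1" "i \<noteq> n - 1" "i \<noteq> n - 2" "i < n"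
      using that unfolding A_def mem_Collect_eq
      using \<open>E 0 \<notin> M\<close> \<open>E 1 \<notin> M\<close> \<open>E (n - 1) \<notin> M\<close> \<open>E (n - 2) \<notin> M\<close> by metis+
    then show ?thesis by auto
  qed
  then have "card A \<le> (n - 2 - 2 + 2) div 3"
    using spaced by (intro card_spaced_le) auto
  also have "\<dots> \<le> n div 3 - xi3 n"
    using n unfolding xi3_def by (cases "n = 3"; simp; presburger)
  finally show "card (M \<inter> cycle_edges n v) \<le> n div 3 - xi3 n"
    using card_le by simp
qed

section \<open>Equally spaced edges\<close>

definition every_third_edge :: "nat \<Rightarrow> nat \<Rightarrow> (nat \<Rightarrow> 'a) \<Rightarrow> 'a set set" where
  "every_third_edge c N v = (\<lambda>j. {v (3 * j + c), v (3 * j + c + 1)}) ` {..<N}"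

lemma Union_every_third_edge:
  "\<Union>(every_third_edge c N v) = v ` {i. \<exists>j<N. i = 3 * j + c \<or> i = 3 * j + c + 1}"
  by (auto simp: every_third_edge_def)

lemma every_third_edge_disjoint_card:
  assumes "inj_on v {c..<c + 3 * N - 1}"
  shows "pairwise disjnt (every_third_edge c N v)" "card (every_third_edge c N v) = N"
proof -
  have v: "a = b" if "v a = v b" "a \<in> {c..<c + 3 * N - 1}" "b \<in> {c..<c + 3 * N - 1}" for a b
    using inj_onD[OF assms] that by blast
  have *: "{v (3 * i + c), v (3 * i + c + 1)} \<inter> {v (3 * j + c), v (3 * j + c + 1)} = {}"
    if "i < N" "j < N" "i \<noteq> j" for i j
  proof -
    have "v a \<noteq> v b" if "a \<in> {3 * i + c, 3 * i + c + 1}" "b \<in> {3 * j + c, 3 * j + c + 1}" for a b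
    proof
      assume "v a = v b"
      then have "a = b" using that \<open>i < N\<close> \<open>j < N\<close> by (intro v) auto
      then show False using that \<open>i \<noteq> j\<close> by auto
    qed
    then show ?thesis by auto
  qed
  then show "pairwise disjnt (every_third_edge c N v)"
    unfolding every_third_edge_def pairwise_def disjnt_def by blast
  have "inj_on (\<lambda>j. {v (3 * j + c), v (3 * j + c + 1)}) {..<N}"
    using * by (intro inj_onI) (metis Int_absorb insert_not_empty lessThan_iff)
  then show "card (every_third_edge c N v) = N"
    by (simp add: every_third_edge_def card_image)
qed

text \<open>
  The vertex indices that occur are \<open>c\<close> and \<open>c + 1\<close> modulo 3. Two successive indices of this
  kind must be \<open>3 * j + c\<close> and \<open>3 * j + c + 1\<close>, in the same pair.
\<close>

lemma every_third_edge_induced: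
  assumes "inj_on v {a..b}" "a \<le> c" "c + 3 * N \<le> b + 2" "a \<le> i" "i + 1 \<le> b"
    and "v i \<in> \<Union>(every_third_edge c N v)" "v (i + 1) \<in> \<Union>(every_third_edge c N v)"
  shows "{v i, v (i + 1)} \<in> every_third_edge c N v"
proof -
  have idx: "\<exists>j<N. k = 3 * j + c \<or> k = 3 * j + c + 1"
    if k: "a \<le> k" "k \<le> b" "v k \<in> \<Union>(every_third_edge c N v)" for k
  proof -
    obtain k' j where k': "v k = v k'" "j < N" "k' = 3 * j + c \<or> k' = 3 * j + c + 1"
      using k(3) unfolding Union_every_third_edge by auto
    then have "k = k'" using k assms(2,3) by (intro inj_onD[OF assms(1)]) auto
    with k' show ?thesis by auto
  qed
  obtain j where j: "j < N" "i = 3 * j + c \<or> i = 3 * j + c + 1"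
    using idx[of i] assms by auto
  obtain j' where j': "i + 1 = 3 * j' + c \<or> i + 1 = 3 * j' + c + 1"
    using idx[of "i + 1"] assms by auto
  from j(2) j' have "i = 3 * j + c" by presburger
  with j(1) show ?thesis unfolding every_third_edge_def by auto
qed

text \<open>
  A maximum induced matching of the cycle that interferes as little as possible with what is
  attached at \<open>v 1\<close>. It always misses \<open>v 1\<close>. If \<open>n mod 3 = 2\<close>, so that \<open>xi3 n = 0\<close>, there is room
  to start at \<open>v 3\<close> and end at \<open>v (n - 1)\<close>, which also misses both neighbours of \<open>v 1\<close>. Otherwise it
  starts at \<open>v 2\<close>. In the third claim \<open>S\<close> stands for the matched vertices in the rest of the graph:
  if \<open>S\<close> contains \<open>v 1\<close> only when \<open>xi3 n = 0\<close>, no cycle edge outside the matching is induced.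
\<close>

lemma every_third_edge_cycle:
  assumes n: "n \<ge> 3" and v: "inj_on v {1..n}"
  defines "M \<equiv> every_third_edge (3 - xi3 n) (n div 3) v"
  shows "M \<subseteq> cycle_edges n v"
    and "\<Union>M \<subseteq> v ` {2..n}"
    and "\<lbrakk>g \<in> cycle_edges n v; g \<subseteq> \<Union>M \<union> S; S \<inter> v ` {1..n} \<subseteq> {v 1}; v 1 \<in> S \<Longrightarrow> xi3 n = 0\<rbrakk>
           \<Longrightarrow> g \<in> M"
    and "pairwise disjnt M" "card M = n div 3"
proof -
  define c where "c = 3 - xi3 n"
  have c: "c \<ge> 2" "c = 2 \<and> xi3 n = 1 \<or> c = 3 \<and> xi3 n = 0 \<and> n mod 3 = 2"
    by (auto simp: c_def xi3_def)
  have M: "M = every_third_edge c (n div 3) v" by (simp add: M_def c_def)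
  have cn: "c + 3 * (n div 3) \<le> n + 2"
    using c(2) by presburger
  have idx: "2 \<le> i" "i \<le> n" "i = n \<Longrightarrow> xi3 n = 1" "i = 2 \<Longrightarrow> xi3 n = 1"
    if "j < n div 3" "i = 3 * j + c \<or> i = 3 * j + c + 1" for i j
  proof -
    show "2 \<le> i" "i \<le> n" using c(1) cn that by linarith+
    have "i mod 3 \<noteq> 2 \<and> i \<noteq> 2" if "c = 3"
      using \<open>i = 3 * j + c \<or> i = 3 * j + c + 1\<close> that by presburger
    then show "i = n \<Longrightarrow> xi3 n = 1" "i = 2 \<Longrightarrow> xi3 n = 1"
      using c(2) by auto
  qed
  show "M \<subseteq> cycle_edges n v"
  proof
    fix e assume "e \<in> M"
    then obtain j where "j < n div 3" "e = {v (3 * j + c), v (3 * j + c + 1)}"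
      by (auto simp: M every_third_edge_def)
    moreover have "3 * j + c + 1 \<le> n" using calculation(1) idx(2)[of j] by blast
    ultimately show "e \<in> cycle_edges n v"
      using c unfolding cycle_edges_def path_edges_def
      by (intro UnI1 CollectI exI[of _ "3 * j + c"]) auto
  qed
  show UM: "\<Union>M \<subseteq> v ` {2..n}"
    unfolding M Union_every_third_edge using idx by force
  have in_UM: "xi3 n = 1" if "i = 2 \<or> i = n" "v i \<in> \<Union>M" for i
  proof -
    obtain i' j where i': "v i = v i'" "j < n div 3" "i' = 3 * j + c \<or> i' = 3 * j + c + 1"
      using \<open>v i \<in> \<Union>M\<close> unfolding M Union_every_third_edge by auto
    then have "i = i'"
      using idx(1,2)[OF i'(2,3)] that n by (intro inj_onD[OF v]) auto
    then show ?thesis using idx(3,4)[OF i'(2,3)] that by auto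
  qed
  show "g \<in> M" if g: "g \<in> cycle_edges n v" "g \<subseteq> \<Union>M \<union> S"
    and S: "S \<inter> v ` {1..n} \<subseteq> {v 1}" "v 1 \<in> S \<Longrightarrow> xi3 n = 0" for S
  proof -
    have v_ne: "v i \<noteq> v 1" if "2 \<le> i" "i \<le> n" for i
      using that inj_onD[OF v, of i 1] by auto
    have v1: "v 1 \<notin> \<Union>M"
    proof
      assume "v 1 \<in> \<Union>M"
      then obtain i where "i \<in> {2..n}" "v 1 = v i" using UM by blast
      with v_ne[of i] show False by simp
    qed
    have vi: "v i \<in> \<Union>M" if "v i \<in> g" "2 \<le> i" "i \<le> n" for i
    proof (rule ccontr)
      assume "v i \<notin> \<Union>M"
      then have "v i \<in> S \<inter> v ` {1..n}" using that g(2) by auto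
      with S(1) v_ne[OF that(2,3)] show False by blast
    qed
    have no1: False if "g = {v 1, v i}" "i = 2 \<or> i = n" for i
    proof -
      have "v 1 \<in> S" using that(1) g(2) v1 by blast
      moreover have "v i \<in> \<Union>M" using that n by (intro vi) auto
      ultimately show False using S(2) in_UM[OF that(2)] by simp
    qed
    consider i where "1 \<le> i" "i < n" "g = {v i, v (i + 1)}" | "g = {v n, v 1}"
      using g(1) by (auto simp: cycle_edges_def path_edges_def)
    then show ?thesis
    proof cases
      case 1
      with no1[of 2] have "i \<noteq> 1" by (auto simp: numeral_2_eq_2)
      with 1 have "v i \<in> \<Union>M" "v (i + 1) \<in> \<Union>M" by (auto intro!: vi simp del: Union_iff)
      with 1 c(1) cn show ?thesis
        unfolding M 1(3) by (intro every_third_edge_induced[OF v]) auto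
    next
      case 2
      then have "g = {v 1, v n}" by (simp add: insert_commute)
      with no1[of n] show ?thesis by blast
    qed
  qed
  have inj': "inj_on v {c..<c + 3 * (n div 3) - 1}"
    using cn c(1) by (intro inj_on_subset[OF v]) auto
  show "pairwise disjnt M" "card M = n div 3"
    unfolding M by (rule every_third_edge_disjoint_card[OF inj'])+
qed

section \<open>The dumbbell graph\<close>

lemma inj_dx: "inj_on dx A" and inj_dy: "inj_on (dy l) A" and inj_Z: "inj_on Z A"
  by (auto simp: inj_on_def dx_def dy_def split: if_splits)

lemma edges_dumbbell:
  "edges (dumbbell n l m) = cycle_edges n dx \<union> path_edges l Z \<union> cycle_edges m (dy l)"
  by (simp add: dumbbell_def edges_def)

lemma path_edge_notin_cycles:
  "{Z i, Z (i + 1)} \<notin> cycle_edges n dx" "{Z i, Z (i + 1)} \<notin> cycle_edges m (dy l)"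
  by (auto simp: cycle_edges_def path_edges_def dx_def dy_def doubleton_eq_iff split: if_splits)

lemma path_edge_in_dumbbell_iff:
  "{Z i, Z (i + 1)} \<in> edges (dumbbell n l m) \<longleftrightarrow> 1 \<le> i \<and> i < l"
proof -
  have "{Z i, Z (i + 1)} \<in> path_edges l Z \<longleftrightarrow> 1 \<le> i \<and> i < l"
    by (auto simp: path_edges_def doubleton_eq_iff)
  then show ?thesis
    unfolding edges_dumbbell using path_edge_notin_cycles by blast
qed

text \<open>
  Let \<open>u\<close> and \<open>w\<close> be 0 or 1 according to whether the first and the last edge of the path are
  matched or unmatched. The path part is bounded by \<open>(l + 1 - u - w) div 3\<close> and the cycles pay
  \<open>(1 - u) * xi3 n\<close> and \<open>(1 - w) * xi3 m\<close>. Replacing \<open>u\<close> by \<open>xi3 n\<close> and \<open>w\<close> by \<open>xi3 m\<close> in the path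
  bound lowers it by at most what the cycles pay.
\<close>

lemma card_induced_matching_dumbbell_le:
  assumes "n \<ge> 3" "m \<ge> 3" "l \<ge> 1" "induced_matching (dumbbell n l m) M"
  shows "card M \<le> n div 3 + m div 3 + (l + 1 - xi3 n - xi3 m) div 3"
proof -
  let ?G = "dumbbell n l m"
  let ?A = "M \<inter> cycle_edges n dx" and ?B = "M \<inter> path_edges l Z"
    and ?C = "M \<inter> cycle_edges m (dy l)"
  have G: "fin_simple_graph ?G" "induced_matching ?G M"
    using assms fin_simple_graph_dumbbell by auto
  have ME: "M \<subseteq> edges ?G" using G(2) by (simp add: induced_matching_def)
  note A = card_matching_cycle_le[OF G assms(1) _ inj_dx]
    and C = card_matching_cycle_le[OF G assms(2) _ inj_dy]
  have "M = ?A \<union> ?B \<union> ?C" using ME by (auto simp: edges_dumbbell)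
  then have "card M \<le> card ?A + card ?B + card ?C"
    by (metis (no_types, lifting) add_le_mono1 card_Un_le le_trans)
  define u :: nat where "u = (if {Z 1, Z (1 + 1)} \<in> M then 0 else 1)"
  define w :: nat where "w = (if {Z (l - 1), Z (l - 1 + 1)} \<in> M then 0 else 1)"
  have uw: "u = 0 \<or> u = 1" "w = 0 \<or> w = 1" by (auto simp: u_def w_def)
  have xi: "xi3 n = 0 \<or> xi3 n = 1" "xi3 m = 0 \<or> xi3 m = 1" by (auto simp: xi3_def)
  have l2: "l \<ge> 2" if "u = 0 \<or> w = 0"
    using that ME path_edge_in_dumbbell_iff[of 1 n l m] path_edge_in_dumbbell_iff[of "l - 1" n l m]
    by (auto simp: u_def w_def split: if_splits)
  have "card ?A \<le> n div 3 - (1 - u) * xi3 n"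
    using A(1) A(2)[where p = "{Z 1, Z (1 + 1)}"] path_edge_notin_cycles(1)[of 1]
    by (auto simp: u_def edges_dumbbell dx_def)
  moreover have "(1 - u) * xi3 n \<le> n div 3"
    using assms(1) uw(1) xi(1) by (elim disjE) auto
  ultimately have cA: "card ?A + (1 - u) * xi3 n \<le> n div 3" by linarith
  have "card ?C \<le> m div 3 - (1 - w) * xi3 m"
    using C(1) C(2)[where p = "{Z (l - 1), Z (l - 1 + 1)}"] path_edge_notin_cycles(2)[of "l - 1"] assms(3)
    by (auto simp: w_def edges_dumbbell dy_def)
  moreover have "(1 - w) * xi3 m \<le> m div 3"
    using assms(2) uw(2) xi(2) by (elim disjE) auto
  ultimately have cC: "card ?C + (1 - w) * xi3 m \<le> m div 3" by linarith
  have "card ?B \<le> (l - w - (1 + u) + 2) div 3"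
  proof (rule card_matching_path_le[OF G _ inj_Z])
    show "path_edges l Z \<subseteq> edges ?G" by (auto simp: edges_dumbbell)
    fix i assume i: "1 \<le> i" "i < l" "{Z i, Z (i + 1)} \<in> M"
    have "u = 0" if "i = 1" using i(3) that by (simp add: u_def)
    moreover have "w = 0" if "i = l - 1" using i(3) that by (simp add: w_def)
    ultimately show "1 + u \<le> i \<and> i < l - w" using i(1,2) uw by linarith
  qed
  (* the two sides differ only by truncation at l = 1 and l = 2, where both are 0 *)
  also have "\<dots> = (l + 1 - u - w) div 3"
  proof (cases "l \<ge> 2")
    case True
    then have "l - w - (1 + u) + 2 = l + 1 - u - w \<or> l = 2 \<and> u = 1 \<and> w = 1"
      using uw by linarith
    then show ?thesis by auto
  next
    case False
    with l2 uw assms(3) have "l = 1" "u = 1" "w = 1" by auto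
    then show ?thesis by simp
  qed
  finally have cB: "card ?B \<le> (l + 1 - u - w) div 3" .
  (* a cycle edge given up gains one unit of path length; crediting three units instead makes
     the credit a whole number of path edges *)
  have "l + 1 - u - w \<le> (l + 1 - xi3 n - xi3 m) + (1 - u) * xi3 n + (1 - w) * xi3 m"
    using uw xi by (elim disjE) simp_all
  also have "\<dots> \<le> (l + 1 - xi3 n - xi3 m) + 3 * ((1 - u) * xi3 n + (1 - w) * xi3 m)"
    by simp
  finally have "(l + 1 - u - w) div 3
      \<le> (l + 1 - xi3 n - xi3 m + 3 * ((1 - u) * xi3 n + (1 - w) * xi3 m)) div 3"
    by (rule div_le_mono)
  also have "\<dots> = (l + 1 - xi3 n - xi3 m) div 3 + (1 - u) * xi3 n + (1 - w) * xi3 m"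
    by simp
  finally show ?thesis
    using cA cB cC \<open>card M \<le> card ?A + card ?B + card ?C\<close> by linarith
qed

text \<open>
  On the path the matching starts at \<open>Z (1 + xi3 n)\<close> and stops at or before \<open>Z (l - xi3 m)\<close>. So it
  reaches a junction only if the matching of the cycle there avoids the neighbours of the
  junction, and no edge of the dumbbell joins two of the three parts.
\<close>

lemma dumbbell_induced_matching_exists:
  assumes "n \<ge> 3" "m \<ge> 3" "l \<ge> 1"
  shows "\<exists>M. induced_matching (dumbbell n l m) M \<and>
    card M = n div 3 + m div 3 + (l + 1 - xi3 n - xi3 m) div 3"
proof -
  let ?G = "dumbbell n l m"
  define s t where "s = xi3 n" and "t = xi3 m"
  define N where "N = (l + 1 - s - t) div 3"
  define A where "A = every_third_edge (3 - xi3 n) (n div 3) dx"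
  define B where "B = every_third_edge (1 + s) N Z"
  define C where "C = every_third_edge (3 - xi3 m) (m div 3) (dy l)"
  note A = every_third_edge_cycle[OF assms(1) inj_dx, folded A_def]
    and C = every_third_edge_cycle[OF assms(2) inj_dy[of l], folded C_def]
  have B_idx: "1 + s \<le> i \<and> i \<le> l - t" if "j < N" "i = 3 * j + (1 + s) \<or> i = 3 * j + (1 + s) + 1" for i j
    using that unfolding N_def by linarith
  have B_path: "B \<subseteq> path_edges l Z"
  proof
    fix e assume "e \<in> B"
    then obtain j where j: "j < N" "e = {Z (3 * j + (1 + s)), Z (3 * j + (1 + s) + 1)}"
      by (auto simp: B_def every_third_edge_def)
    moreover have "3 * j + (1 + s) + 1 \<le> l" using B_idx[of j] j(1) by fastforce
    ultimately show "e \<in> path_edges l Z"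
      unfolding path_edges_def by (intro CollectI exI[of _ "3 * j + (1 + s)"]) auto
  qed
  have UB: "\<Union>B \<subseteq> Z ` {1 + s..l - t}"
    unfolding B_def Union_every_third_edge using B_idx by force
  have "dx ` {2..n} = X ` {2..n}" "dy l ` {2..m} = Y ` {2..m}"
    by (auto simp: dx_def dy_def intro!: image_cong)
  then have UA: "\<Union>A \<subseteq> X ` {2..n}" and UC: "\<Union>C \<subseteq> Y ` {2..m}"
    using A(2) C(2) by simp_all
  have B: "pairwise disjnt B" "card B = N"
    unfolding B_def by (auto intro!: every_third_edge_disjoint_card inj_Z)
  have cross: "disjnt e f" if "e \<in> A \<and> f \<in> B \<or> e \<in> A \<and> f \<in> C \<or> e \<in> B \<and> f \<in> C" for e f
    using that UA UB UC unfolding disjnt_def by blast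
  have ne: "e \<noteq> {}" if "e \<in> A \<union> B \<union> C" for e
    using that by (auto simp: A_def B_def C_def every_third_edge_def)
  let ?M = "A \<union> B \<union> C"
  have ME: "?M \<subseteq> edges ?G"
    using A(1) B_path C(1) by (auto simp: edges_dumbbell)
  have "pairwise disjnt ?M"
    using A(4) B(1) C(4) cross unfolding pairwise_def by (auto simp: disjnt_sym)
  moreover have "g \<in> ?M" if g: "g \<in> edges ?G" "g \<subseteq> \<Union>?M" for g
  proof -
    consider "g \<in> cycle_edges n dx" | "g \<in> path_edges l Z" | "g \<in> cycle_edges m (dy l)"
      using g(1) by (auto simp: edges_dumbbell)
    then show ?thesis
    proof cases
      case 1
      have "(\<Union>B \<union> \<Union>C) \<inter> dx ` {1..n} \<subseteq> {dx 1}"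
        using UB UC by (auto simp: dx_def)
      moreover have "xi3 n = 0" if "dx 1 \<in> \<Union>B \<union> \<Union>C"
        using that UB UC by (auto simp: dx_def s_def)
      moreover have "g \<subseteq> \<Union>A \<union> (\<Union>B \<union> \<Union>C)" using g(2) by blast
      ultimately have "g \<in> A" using 1 by (intro A(3))
      then show ?thesis by blast
    next
      case 2
      then obtain i where i: "1 \<le> i" "i < l" "g = {Z i, Z (i + 1)}"
        by (auto simp: path_edges_def)
      then have "Z i \<in> \<Union>B" "Z (i + 1) \<in> \<Union>B"
        using g(2) UA UC by blast+
      moreover have "1 + s + 3 * N \<le> l + 2"
        using assms(3) by (auto simp: N_def s_def xi3_def)
      ultimately have "g \<in> B"
        using i unfolding i(3) B_def by (intro every_third_edge_induced[where a = 1 and b = l] inj_Z) auto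
      then show ?thesis by blast
    next
      case 3
      have "(\<Union>A \<union> \<Union>B) \<inter> dy l ` {1..m} \<subseteq> {dy l 1}"
      proof
        fix v assume v: "v \<in> (\<Union>A \<union> \<Union>B) \<inter> dy l ` {1..m}"
        then have "v \<in> X ` {2..n} \<union> Z ` {1 + s..l - t}" using UA UB by blast
        with v show "v \<in> {dy l 1}" by (auto simp: dy_def split: if_splits)
      qed
      moreover have "xi3 m = 0" if "dy l 1 \<in> \<Union>A \<union> \<Union>B"
      proof -
        have "dy l 1 \<in> X ` {2..n} \<union> Z ` {1 + s..l - t}" using that UA UB by blast
        then show ?thesis using assms(3) by (auto simp: dy_def t_def)
      qed
      moreover have "g \<subseteq> \<Union>C \<union> (\<Union>A \<union> \<Union>B)" using g(2) by blast
      ultimately have "g \<in> C" using 3 by (intro C(3))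
      then show ?thesis by blast
    qed
  qed
  ultimately have "induced_matching ?G ?M"
    using ME unfolding induced_matching_def induced_subgraph_def by (auto simp: edges_def)
  moreover have "card ?M = n div 3 + m div 3 + N"
  proof -
    have fin: "finite A" "finite B" "finite C"
      by (auto simp: A_def B_def C_def every_third_edge_def)
    have "\<not> disjnt e e" if "e \<in> ?M" for e
      using ne[OF that] by simp
    with cross have "A \<inter> B = {}" "(A \<union> B) \<inter> C = {}" by blast+
    with fin have "card ?M = card A + card B + card C"
      by (simp add: card_Un_disjoint)
    then show ?thesis using A(5) B(2) C(5) by simp
  qed
  ultimately show ?thesis unfolding N_def s_def t_def by blast
qed

theorem theorem1:
  fixes n m l :: nat
  assumes "n \<ge> 3" and "m \<ge> 3" and "l \<ge> 1"
  shows "int (induced_matching_number (dumbbell n l m)) =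
    \<lfloor>real n / 3\<rfloor> + \<lfloor>real m / 3\<rfloor> + \<lfloor>(real l - real (xi3 n) - real (xi3 m) + 1) / 3\<rfloor>"
proof -
  let ?G = "dumbbell n l m" and ?k = "l + 1 - xi3 n - xi3 m"
  have "finite {M. induced_matching ?G M}"
    using assms finite_induced_matchings fin_simple_graph_dumbbell by blast
  then have nu: "induced_matching_number ?G = n div 3 + m div 3 + ?k div 3"
    unfolding induced_matching_number_def
    using card_induced_matching_dumbbell_le[OF assms]
      dumbbell_induced_matching_exists[OF assms]
    by (intro Max_eqI) (auto simp: image_iff)
  have "xi3 n \<le> 1" "xi3 m \<le> 1" by (auto simp: xi3_def)
  then have "real l - real (xi3 n) - real (xi3 m) + 1 = real ?k"
    using assms(3) by (simp add: of_nat_diff)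
  moreover have "\<lfloor>real k / 3\<rfloor> = int (k div 3)" for k
    using floor_divide_of_nat_eq[of k 3] by simp
  ultimately show ?thesis unfolding nu by (simp only: of_nat_add)
qed

end
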